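(* Let $L,a,b>0$ with $a<b$, let $h:[a,b]\to\mathbb R$ be an $L$-Lipschitz mapping, and let $0<t\le\frac{1}{1+L}$. Let $e\in[a,b]$, put $x_0=e$, and define $$x_{n+1}=(1-t)x_n+t\,h(x_n)\quad\text{for } n\ge 0,$$ as long as $x_n\in[a,b]$. Then $\{x_n\}$ is a monotone sequence that either converges to a fixed point of $h$ or exits the interval $[a,b]$. That is, either $x_n\in[a,b]$ for all $n\ge 0$ and $\{x_n\}$ is monotone and converges to a fixed point of $h$, or there is $N\ge 1$ such that $x_0,\dots,x_{N-1}\in[a,b]$, $x_N\notin[a,b]$, and the finite sequence $x_0,\dots,x_N$ is monotone.
   Context: A function $h:[a,b]\to\mathbb R$ is called $L$-Lipschitz (for $L>0$) if $|h(x)-h(y)|\le L|x-y|$ for all $x,y\in[a,b]$. A fixed point of $h$ is a point $x\in[a,b]$ with $h(x)=x$. Monotone means nondecreasing or nonincreasing (constant sequences are included). Since $h$ is only defined on $[a,b]$ and need not map $[a,b]$ into itself, the recursion stops at the first index $N$ with $x_N\notin[a,b]$, in which case the sequence is said to exit the interval. *)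

theory Defs
  imports "HOL-Analysis.Lipschitz"
begin

end

theory Submission imports Defs begin

text \<open>The averaged map \<open>g y = (1 - t) * y + t * h y\<close> is nondecreasing on \<open>[a, b]\<close>: for \<open>y \<le> z\<close>,
  the Lipschitz bound gives \<open>g z - g y \<ge> (1 - t - t * L) * (z - y) \<ge> 0\<close>. Applying \<open>g\<close> repeatedly to
  the comparison of \<open>x 0\<close> with \<open>x 1\<close> therefore shows that the orbit is monotone as long as it stays
  in \<open>[a, b]\<close>; if it never leaves, its limit is fixed by the continuous map \<open>g\<close>, hence by \<open>h\<close>.\<close>

text \<open>Keeping the order \<open>R\<close> abstract lets one induction serve both
  \<open>(\<le>)\<close> and \<open>(\<ge>)\<close>.\<close>

lemma monotone_on_atMost_SucI:
  fixes x :: "nat \<Rightarrow> 'a"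
  assumes "reflp R" "transp R" and step: "\<And>k. k < N \<Longrightarrow> R (x k) (x (Suc k))"
  shows "monotone_on {..N} (\<le>) R x"
proof (rule monotone_onI)
  fix i j assume "j \<in> {..N}" "i \<le> j"
  from \<open>i \<le> j\<close> have "j \<le> N \<longrightarrow> R (x i) (x j)"
  proof (induction j rule: dec_induct)
    case base
    then show ?case using \<open>reflp R\<close> by (auto dest: reflpD)
  next
    case (step k)
    then show ?case using assms(3)[of k] \<open>transp R\<close> by (auto dest: transpD)
  qed
  then show "R (x i) (x j)" using \<open>j \<in> {..N}\<close> by simp
qed

text \<open>Each application of \<open>g\<close> carries the comparison of two consecutive terms to
  the next pair. Only the terms before \<open>x N\<close> must lie in \<open>S\<close>, so the
  conclusion still covers a last term that has left \<open>S\<close>.\<close>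

lemma monotone_on_orbit:
  fixes x :: "nat \<Rightarrow> 'a"
  assumes "reflp R" "transp R" and g: "monotone_on S R R g"
    and orbit: "\<And>k. k < N \<Longrightarrow> x k \<in> S \<and> x (Suc k) = g (x k)"
    and start: "R (x 0) (x 1)"
  shows "monotone_on {..N} (\<le>) R x"
proof -
  have "k < N \<longrightarrow> R (x k) (x (Suc k))" for k
  proof (induction k)
    case 0
    then show ?case using start by simp
  next
    case (Suc k)
    then show ?case using orbit[of k] orbit[of "Suc k"] monotone_onD[OF g] by auto
  qed
  then show ?thesis using assms(1,2) by (intro monotone_on_atMost_SucI) auto
qed

text \<open>A nondecreasing map also preserves the reversed order, so the first step alone decides
  the direction of the orbit.\<close>

lemma mono_or_antimono_on_orbit:
  fixes x :: "nat \<Rightarrow> 'a::linorder"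
  assumes g: "mono_on S g"
    and orbit: "\<And>k. k < N \<Longrightarrow> x k \<in> S \<and> x (Suc k) = g (x k)"
  shows "(x 0 \<le> x 1 \<longrightarrow> mono_on {..N} x) \<and> (x 1 \<le> x 0 \<longrightarrow> antimono_on {..N} x)"
proof -
  have "monotone_on S (\<ge>) (\<ge>) g"
    using g by (auto simp: monotone_on_def)
  then show ?thesis
    using monotone_on_orbit[of "(\<le>)" S g N x] monotone_on_orbit[of "(\<ge>)" S g N x] g orbit
    by simp
qed

lemma mono_on_averaged_lipschitz:
  fixes h :: "real \<Rightarrow> real"
  assumes lip: "L-lipschitz_on S h" and "0 \<le> t" "t * (1 + L) \<le> 1"
  shows "mono_on S (\<lambda>y. (1 - t) * y + t * h y)"
proof (rule mono_onI)
  fix y z assume yz: "y \<in> S" "z \<in> S" "y \<le> z"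
  have "\<bar>h y - h z\<bar> \<le> L * \<bar>y - z\<bar>"
    using lipschitz_onD[OF lip yz(1,2)] by (simp add: dist_real_def)
  then have "h y - h z \<le> L * (z - y)"
    using yz by simp
  then have "t * (h y - h z) \<le> t * (L * (z - y))"
    using \<open>0 \<le> t\<close> by (rule mult_left_mono)
  \<comment> \<open>This is what remains of \<open>(1 - t) * (z - y)\<close> after subtracting the
    largest possible loss \<open>t * L * (z - y)\<close>.\<close>
  moreover have "0 \<le> (1 - t * (1 + L)) * (z - y)"
    using assms yz by (intro mult_nonneg_nonneg) auto
  ultimately show "(1 - t) * y + t * h y \<le> (1 - t) * z + t * h z"
    by (simp add: algebra_simps)
qed

text \<open>The shifted sequence tends both to \<open>g p\<close>, by continuity, and to
  \<open>p\<close>; limits in a Hausdorff space are unique. Closedness puts \<open>p\<close> where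
  \<open>g\<close> is continuous.\<close>

lemma LIMSEQ_orbit_fixed_point:
  fixes g :: "'a::t2_space \<Rightarrow> 'a"
  assumes "continuous_on S g" "closed S" "\<And>n. x n \<in> S" "\<And>n. x (Suc n) = g (x n)"
    and lim: "x \<longlonglongrightarrow> p"
  shows "p \<in> S \<and> g p = p"
proof
  show "p \<in> S"
    using assms by (metis closed_sequentially)
  then have "(\<lambda>n. g (x n)) \<longlonglongrightarrow> g p"
    using assms by (intro continuous_on_tendsto_compose[OF assms(1) lim]) auto
  moreover have "(\<lambda>n. g (x n)) \<longlonglongrightarrow> p"
    using LIMSEQ_Suc[OF lim] assms(4) by simp
  ultimately show "g p = p"
    by (rule LIMSEQ_unique)
qed

theorem corollary2p1:
  fixes L a b t e :: real and h :: "real \<Rightarrow> real" and x :: "nat \<Rightarrow> real"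
  assumes "0 < L" and "0 < a" and "0 < b" and "a < b"
    and "L-lipschitz_on {a..b} h"
    and "0 < t" and "t \<le> 1 / (1 + L)"
    and "e \<in> {a..b}"
    and "x 0 = e"
    and "\<And>n. (\<forall>k\<le>n. x k \<in> {a..b}) \<Longrightarrow> x (Suc n) = (1 - t) * x n + t * h (x n)"
  shows "((\<forall>n. x n \<in> {a..b}) \<and> monoseq x \<and>
            (\<exists>p\<in>{a..b}. h p = p \<and> x \<longlonglongrightarrow> p))
       \<or> (\<exists>N\<ge>1. (\<forall>n<N. x n \<in> {a..b}) \<and> x N \<notin> {a..b} \<and>
            (mono_on {..N} x \<or> antimono_on {..N} x))"
proof -
  define g where "g y = (1 - t) * y + t * h y" for y
  have "t * (1 + L) \<le> 1"
    using assms(1,7) by (simp add: pos_le_divide_eq)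
  then have mono: "mono_on {a..b} g"
    using mono_on_averaged_lipschitz[OF assms(5)] assms(6) unfolding g_def by simp
  \<comment> \<open>Stated for every \<open>N\<close> so as to serve both cases: all prefixes of an
    orbit that stays, and the prefix ending at the exit point.\<close>
  have monotone: "(x 0 \<le> x 1 \<longrightarrow> mono_on {..N} x) \<and> (x 1 \<le> x 0 \<longrightarrow> antimono_on {..N} x)"
    if "\<forall>n<N. x n \<in> {a..b}" for N
  proof (rule mono_or_antimono_on_orbit[OF mono])
    fix k assume "k < N"
    then show "x k \<in> {a..b} \<and> x (Suc k) = g (x k)"
      using that assms(10)[of k] by (auto simp: g_def)
  qed
  show ?thesis
  proof (cases "\<forall>n. x n \<in> {a..b}")
    case True
    have "monoseq x"
    proof (cases "x 0 \<le> x 1")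
      case le: True
      have "x n \<le> x (Suc n)" for n
        using monotone[of "Suc n"] True le mono_onD[of "{..Suc n}" x n "Suc n"] by auto
      then show ?thesis by (simp add: monoseq_Suc)
    next
      case ge: False
      have "x (Suc n) \<le> x n" for n
        using monotone[of "Suc n"] True ge monotone_onD[of "{..Suc n}" "(\<le>)" "(\<ge>)" x n "Suc n"]
        by auto
      then show ?thesis by (simp add: monoseq_Suc)
    qed
    moreover have "Bseq x"
    proof (rule BseqI')
      \<comment> \<open>Since \<open>0 < a\<close>, every term is positive and equals its
        norm.\<close>
      show "norm (x n) \<le> b" for n
        using True[rule_format, of n] assms(2) by simp
    qed
    ultimately obtain p where lim: "x \<longlonglongrightarrow> p"
      using Bseq_monoseq_convergent convergentD by blast
    have "continuous_on {a..b} g"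
      unfolding g_def
      by (intro continuous_intros lipschitz_on_continuous_on[OF assms(5)])
    moreover have "x (Suc n) = g (x n)" for n
      using True assms(10) by (simp add: g_def)
    ultimately have p: "p \<in> {a..b} \<and> g p = p"
      using True lim by (intro LIMSEQ_orbit_fixed_point[where x = x]) auto
    then have "t * (h p - p) = 0"
      by (simp add: g_def algebra_simps)
    then have "h p = p"
      using assms(6) by simp
    then show ?thesis using True \<open>monoseq x\<close> p lim by blast
  next
    case False
    define N where "N = (LEAST n. x n \<notin> {a..b})"
    have N: "x N \<notin> {a..b}"
      unfolding N_def using False by (metis (mono_tags, lifting) LeastI)
    have before: "\<forall>n<N. x n \<in> {a..b}"
      unfolding N_def using not_less_Least by blast
    \<comment> \<open>The starting point \<open>e\<close> lies in the interval, so the first exit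
      comes later.\<close>
    have "N \<noteq> 0" using N assms(8,9) by metis
    moreover have "mono_on {..N} x \<or> antimono_on {..N} x"
      using monotone[OF before] linear by blast
    ultimately show ?thesis using N before by (metis One_nat_def Suc_leI neq0_conv)
  qed
qed

end
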